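(* For every $K_3N$ $n=pqr$, $A<3H-\sqrt{\dfrac H2}$.
   Context: A $K_3N$ (Korselt number with three factors) is an integer $n$ together with a factorisation $n=pqr$, where $1<p<q<r$ are odd integers (not necessarily prime) such that each of $p-1,\ q-1,\ r-1$ divides $n-1$, and such that $E:=\dfrac{pq-1}{r-1}$ (which is an integer by the divisibility condition) satisfies $E\ge 2$. Put $H:=\gcd(p-1,q-1,r-1)$ and $A:=\frac{p-1}{H}$. *)

theory Defs
  imports Complex_Main
begin

text \<open>
  Korselt numbers with three factors, given by the factorisation \<open>n = p * q * r\<close>.  All quantities
  are integers.
\<close>

definition korselt_E :: "int \<Rightarrow> int \<Rightarrow> int \<Rightarrow> int" where
  "korselt_E p q r = (p * q - 1) div (r - 1)"

definition K3N :: "int \<Rightarrow> int \<Rightarrow> int \<Rightarrow> int \<Rightarrow> bool" where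
  "K3N n p q r \<longleftrightarrow>
     n = p * q * r \<and>
     1 < p \<and> p < q \<and> q < r \<and>
     odd p \<and> odd q \<and> odd r \<and>
     (p - 1) dvd (n - 1) \<and> (q - 1) dvd (n - 1) \<and> (r - 1) dvd (n - 1) \<and>
     korselt_E p q r \<ge> 2"

definition korselt_H :: "int \<Rightarrow> int \<Rightarrow> int \<Rightarrow> int" where
  "korselt_H p q r = gcd (p - 1) (gcd (q - 1) (r - 1))"

definition korselt_A :: "int \<Rightarrow> int \<Rightarrow> int \<Rightarrow> int" where
  "korselt_A p q r = (p - 1) div korselt_H p q r"

text \<open>The integer divisions in \<open>korselt_E\<close> and \<open>korselt_A\<close> are exact.\<close>

lemma korselt_E_exact:
  fixes p q r :: int
  assumes "(r - 1) dvd (p * q * r - 1)"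
  shows "korselt_E p q r * (r - 1) = p * q - 1"
proof -
  have "p * q - 1 = (p * q * r - 1) - p * q * (r - 1)"
    by (simp add: algebra_simps)
  moreover have "(r - 1) dvd p * q * (r - 1)"
    by simp
  ultimately have "(r - 1) dvd (p * q - 1)"
    using assms by (metis dvd_diff)
  then show ?thesis
    by (simp add: korselt_E_def)
qed

lemma korselt_A_exact: "korselt_A p q r * korselt_H p q r = p - 1"
  by (simp add: korselt_A_def korselt_H_def)

end

theory Submission
  imports Defs
begin

text \<open>
  Write \<open>p = H A + 1\<close>, \<open>q = H B + 1\<close>, \<open>r = H C + 1\<close>.  The divisibility conditions make \<open>A\<close>, \<open>B\<close>, \<open>C\<close>
  pairwise coprime, so that \<open>K A B C = H (A B + B C + C A) + A + B + C\<close> for some positive integer \<open>K\<close>.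
  For \<open>K \<ge> 2\<close> the number \<open>A\<close> is far smaller than claimed.  For \<open>K = 1\<close> put \<open>A = 3 H + a\<close>,
  \<open>B = 3 H + b\<close>, \<open>C = 3 H + c\<close>; the difference of the two sides is a cubic polynomial \<open>f\<close> in \<open>a, b, c\<close> that
  is increasing in \<open>b\<close> and \<open>c\<close>.  If \<open>a = -t\<close> with \<open>2 t\<^sup>2 \<le> H\<close>, then \<open>f < 0\<close> as soon as \<open>a + b + c \<le> 0\<close>,
  and, apart from four small pairs \<open>(H, t)\<close>, \<open>f > 0\<close> as soon as \<open>a + b + c \<ge> 1\<close>: by integrality there
  is no room for a zero of \<open>f\<close>.
\<close>

section \<open>Sign of the defect polynomial\<close>

text \<open>At \<open>A = B = C = 3 * H\<close> the terms \<open>A * B * C\<close> and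
  \<open>H * (A * B + B * C + C * A)\<close> agree, so this shift cancels
  \<open>H^3\<close>.\<close>

definition shifted_defect :: "int \<Rightarrow> int \<Rightarrow> int \<Rightarrow> int \<Rightarrow> int" where
  "shifted_defect H a b c =
     3 * H\<^sup>2 * (a + b + c) + 2 * H * (a * b + b * c + c * a) + a * b * c - 9 * H - (a + b + c)"

lemma shifted_defect_eq:
  "shifted_defect H (A - 3 * H) (B - 3 * H) (C - 3 * H) =
     A * B * C - (H * (A * B + B * C + C * A) + A + B + C)"
  by (simp add: shifted_defect_def algebra_simps power2_eq_square)

lemma shifted_defect_commute: "shifted_defect H a b c = shifted_defect H a c b"
  by (simp add: shifted_defect_def algebra_simps)

text \<open>The slope in the last argument is \<open>(2 * H + a) * (2 * H + b) - H * H - 1\<close>,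
  and both factors are at least \<open>3 * H / 2\<close>.\<close>

lemma shifted_defect_mono:
  assumes H: "2 \<le> H" and a: "- H \<le> 2 * a" and b: "- H \<le> 2 * b" and cd: "c \<le> d"
  shows "shifted_defect H a b c \<le> shifted_defect H a b d"
proof -
  have "(3 * H) * (3 * H) \<le> (4 * H + 2 * a) * (4 * H + 2 * b)"
    by (rule mult_mono) (use assms in auto)
  moreover have "2 * 2 \<le> H * H"
    using H by (intro mult_mono) auto
  ultimately have "0 \<le> (2 * H + a) * (2 * H + b) - H * H - 1"
    by (simp add: algebra_simps)
  then have "0 \<le> ((2 * H + a) * (2 * H + b) - H * H - 1) * (d - c)"
    using cd by simp
  also have "\<dots> = shifted_defect H a b d - shifted_defect H a b c"
    by (simp add: shifted_defect_def algebra_simps power2_eq_square)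
  finally show ?thesis by simp
qed

text \<open>Raise \<open>c\<close> to \<open>t - b\<close>: the shifts then sum to zero, so twice
  the sum of their pairwise products is minus the sum of their squares, which absorbs the cubic term
  because \<open>t \<le> H\<close>.\<close>

lemma shifted_defect_neg:
  assumes H: "2 \<le> H" and t: "0 \<le> t" "2 * t \<le> H" and b: "- t \<le> b" and s: "b + c \<le> t"
  shows "shifted_defect H (- t) b c < 0"
proof -
  let ?d = "t - b"
  have "shifted_defect H (- t) b c \<le> shifted_defect H (- t) b ?d"
    by (rule shifted_defect_mono) (use assms in auto)
  also have "\<dots> = - H * (t\<^sup>2 + b\<^sup>2 + ?d\<^sup>2) - t * (b * ?d) - 9 * H"
    by (simp add: shifted_defect_def algebra_simps power2_eq_square)
  also have "\<dots> < 0"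
  proof -
    have "- (x * y) \<le> x\<^sup>2 + y\<^sup>2" for x y :: int
    proof -
      have "0 \<le> (x + y)\<^sup>2 + x\<^sup>2 + y\<^sup>2" by simp
      then show ?thesis by (simp add: power2_sum)
    qed
    then have "- (b * ?d) \<le> b\<^sup>2 + ?d\<^sup>2" .
    then have "t * (- (b * ?d)) \<le> t * (b\<^sup>2 + ?d\<^sup>2)"
      using t by (intro mult_left_mono) auto
    also have "\<dots> \<le> H * (t\<^sup>2 + b\<^sup>2 + ?d\<^sup>2)"
      using t H by (intro mult_mono) auto
    finally show ?thesis using H by simp
  qed
  finally show ?thesis .
qed

text \<open>Distinct nonnegative shifts sum to at least 3, and
  \<open>3 * (3 * H^2 - 1) > 9 * H\<close>. This rules out \<open>A \<ge> 3 * H\<close>.\<close>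

lemma shifted_defect_pos:
  assumes H: "2 \<le> H" and a: "0 \<le> a" "a < b" "b < c"
  shows "0 < shifted_defect H a b c"
proof -
  have H2: "2 * H \<le> H\<^sup>2" using H by (simp add: power2_eq_square)
  have "3 * (3 * H\<^sup>2 - 1) \<le> (a + b + c) * (3 * H\<^sup>2 - 1)"
    using a H H2 by (intro mult_right_mono) auto
  moreover have "0 \<le> 2 * H * (a * b + b * c + c * a)" "0 \<le> a * b * c"
    using a H by simp_all
  ultimately have "9 * H\<^sup>2 - 3 - 9 * H \<le> shifted_defect H a b c"
    by (simp add: shifted_defect_def algebra_simps)
  with H2 H show ?thesis by simp
qed

text \<open>
  On the line \<open>b + c = t + 1\<close> the defect is a concave quadratic in \<open>b\<close>; the bound below is its common value at
  \<open>b = 1 - t\<close> and \<open>b = 2 t\<close>.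
\<close>

lemma shifted_defect_lower_bound:
  assumes H: "2 \<le> H" and t: "1 \<le> t" "2 * t \<le> H"
    and b: "1 - t \<le> b" and bc: "b < c" and s: "t + 1 \<le> b + c"
  shows "3 * H * (H - 2 * t\<^sup>2) + (2 * t - 9) * H + 2 * t ^ 3 - 2 * t\<^sup>2 - 1
           \<le> shifted_defect H (- t) b c"
proof -
  let ?P = "3 * H * (H - 2 * t\<^sup>2) + (2 * t - 9) * H + 2 * t ^ 3 - 2 * t\<^sup>2 - 1"
  have bound: "?P \<le> shifted_defect H (- t) b' (t + 1 - b')" if "1 - t \<le> b'" "b' \<le> 2 * t" for b'
  proof -
    \<comment> \<open>The quadratic minus its common value at \<open>1 - t\<close> and
      \<open>2 * t\<close> has these roots; its leading coefficient is
      \<open>t - 2 * H\<close>.\<close>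
    have "0 \<le> (b' + t - 1) * (2 * t - b') * (2 * H - t)"
      using that t by simp
    also have "\<dots> = shifted_defect H (- t) b' (t + 1 - b') - ?P"
      by (simp add: shifted_defect_def algebra_simps power2_eq_square power3_eq_cube)
    finally show ?thesis by simp
  qed
  show ?thesis
  proof (cases "b \<le> 2 * t")
    case True
    have "shifted_defect H (- t) b (t + 1 - b) \<le> shifted_defect H (- t) b c"
      by (rule shifted_defect_mono) (use assms in auto)
    with bound[OF b True] show ?thesis by simp
  next
    case False
    \<comment> \<open>Both \<open>b\<close> and \<open>c\<close> exceed \<open>2 * t\<close>: lower
      \<open>b\<close> to \<open>2 * t\<close>, then \<open>c\<close> to \<open>1 - t\<close>, an
      end of the segment treated above.\<close>
    have "shifted_defect H (- t) (2 * t) (1 - t) \<le> shifted_defect H (- t) (2 * t) c"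
      by (rule shifted_defect_mono) (use assms False in auto)
    also have "\<dots> = shifted_defect H (- t) c (2 * t)"
      by (rule shifted_defect_commute)
    also have "\<dots> \<le> shifted_defect H (- t) c b"
      by (rule shifted_defect_mono) (use assms False in auto)
    also have "\<dots> = shifted_defect H (- t) b c"
      by (rule shifted_defect_commute)
    finally show ?thesis using bound[of "2 * t"] t by simp
  qed
qed

text \<open>\<open>2 * t - 9\<close> is negative only for \<open>t \<le> 4\<close>; a small gap
  \<open>H - 2 * t^2\<close>, or at \<open>H = 32\<close> the terms in \<open>t\<close> alone, make
  up for it. At the four excluded pairs the bound is negative.\<close>

lemma lower_bound_pos:
  fixes H t :: int
  assumes H: "even H" and t: "1 \<le> t" "2 * t\<^sup>2 \<le> H"
    and ne: "(H, t) \<notin> {(2, 1), (4, 1), (8, 2), (18, 3)}"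
  shows "0 < 3 * H * (H - 2 * t\<^sup>2) + (2 * t - 9) * H + 2 * t ^ 3 - 2 * t\<^sup>2 - 1"
proof -
  have H0: "0 \<le> H" using t(2) zero_le_power2[of t] by linarith
  define P where "P = 3 * H * (H - 2 * t\<^sup>2)"
  have pos: "c * H \<le> P" if "c \<le> 3 * (H - 2 * t\<^sup>2)" for c
    using mult_right_mono[OF that, of H] t zero_le_power2[of t] by (simp add: P_def algebra_simps)
  consider "t = 1" | "t = 2" | "t = 3" | "t = 4" | "5 \<le> t"
    using t by linarith
  then have "0 < P + (2 * t - 9) * H + 2 * t ^ 3 - 2 * t\<^sup>2 - 1"
  proof cases
    case 1
    then have "6 \<le> H" using H t ne by (auto elim!: evenE)
    with 1 pos[of 8] show ?thesis by simp
  next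
    case 2
    then have "10 \<le> H" using H t ne by (auto elim!: evenE)
    with 2 pos[of 6] show ?thesis by simp
  next
    case 3
    then have "20 \<le> H" using H t ne by (auto elim!: evenE)
    with 3 pos[of 6] show ?thesis by simp
  next
    case 4
    then have "H = 32 \<or> 33 \<le> H" using t by auto
    with 4 pos[of 0] pos[of 3] show ?thesis by auto
  next
    case 5
    have "0 \<le> P" "0 \<le> (2 * t - 9) * H"
      using t 5 H0 by (auto simp: P_def intro!: mult_nonneg_nonneg)
    moreover have "5 * 5 \<le> t * t" using 5 by (intro mult_mono) auto
    moreover have "5 * t\<^sup>2 \<le> t ^ 3"
      using 5 by (simp add: power2_eq_square power3_eq_cube mult_right_mono)
    ultimately show ?thesis by (simp add: power2_eq_square)
  qed
  then show ?thesis by (simp add: P_def)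
qed

section \<open>Exceptional pairs and the case \<open>K = 1\<close>\<close>

text \<open>A finite check: the equation is linear in \<open>C\<close>, \<open>C > B\<close> bounds
  \<open>B\<close>, and each remaining \<open>B\<close> violates divisibility.\<close>

lemma no_small_solution:
  fixes H t B C :: int
  assumes Ht: "(H, t) \<in> {(2, 1), (4, 1), (8, 2), (18, 3)}"
    and A: "A = 3 * H - t" "A < B" and BC: "B < C"
  shows "H * (A * B + B * C + C * A) + A + B + C \<noteq> A * B * C"
proof
  assume eq: "H * (A * B + B * C + C * A) + A + B + C = A * B * C"
  \<comment> \<open>The constants in the cases come from reading this as
    \<open>((A - H) * B - (H * A + 1)) * C = (H * A + 1) * B + A\<close>.\<close>
  have *: "(A * B - H * (A + B) - 1) * C = H * A * B + A + B"
    using eq by (simp add: algebra_simps)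
  have le: "(m * B - k) * (B + 1) \<le> (m * B - k) * C" if "0 \<le> m * B - k" for m k
    using BC that by (intro mult_left_mono) auto
  \<comment> \<open>The quadratic \<open>k * B^2 - u * B - v\<close> is positive from
    \<open>m\<close> on.\<close>
  have lt: "B < m"
    if "k * (B * B) \<le> u * B + v" "0 \<le> k" "u \<le> k * m" "v < (k * m - u) * m" "0 \<le> m" for k u v m
  proof (rule ccontr)
    assume "\<not> B < m"
    then have "m \<le> B" by simp
    then have "k * (m * B) \<le> k * (B * B)" "(k * m - u) * m \<le> (k * m - u) * B"
      using that by (auto intro!: mult_left_mono mult_right_mono)
    with that show False by (simp add: algebra_simps)
  qed
  from Ht consider "H = 2" "t = 1" | "H = 4" "t = 1" | "H = 8" "t = 2" | "H = 18" "t = 3"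
    by auto
  then show False
  proof cases
    case 1
    then have e: "(3 * B - 11) * C = 11 * B + 5" and B: "6 \<le> B"
      using * A by (auto simp: algebra_simps)
    have "3 * (B * B) \<le> 19 * B + 16" using le[of 3 11] e B by (simp add: algebra_simps)
    then have "B < 10" by (rule lt) simp_all
    with B have range: "B \<in> {6, 7, 8, 9}" by auto
    from e have "3 * B - 11 dvd 11 * B + 5" by (metis dvd_triv_left)
    with range show False by auto
  next
    case 2
    then have e: "(7 * B - 45) * C = 45 * B + 11" and B: "12 \<le> B"
      using * A by (auto simp: algebra_simps)
    have "7 * (B * B) \<le> 83 * B + 56" using le[of 7 45] e B by (simp add: algebra_simps)
    then have "B < 13" by (rule lt) simp_all
    with B have range: "B = 12" by auto
    from e have "7 * B - 45 dvd 45 * B + 11" by (metis dvd_triv_left)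
    with range show False by auto
  next
    case 3
    then have e: "(14 * B - 177) * C = 177 * B + 22" and B: "23 \<le> B"
      using * A by (auto simp: algebra_simps)
    have "14 * (B * B) \<le> 340 * B + 199" using le[of 14 177] e B by (simp add: algebra_simps)
    then have "B < 26" by (rule lt) simp_all
    with B have range: "B \<in> {23, 24, 25}" by auto
    from e have "14 * B - 177 dvd 177 * B + 22" by (metis dvd_triv_left)
    with range show False by auto
  next
    case 4
    then have e: "(33 * B - 919) * C = 919 * B + 51" and B: "52 \<le> B"
      using * A by (auto simp: algebra_simps)
    have "33 * (B * B) \<le> 1805 * B + 970" using le[of 33 919] e B by (simp add: algebra_simps)
    then have "B < 56" by (rule lt) simp_all
    with B have range: "B \<in> {52, 53, 54, 55}" by auto
    from e have "33 * B - 919 dvd 919 * B + 51" by (metis dvd_triv_left)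
    with range show False by auto
  qed
qed

lemma unit_quotient_bound:
  fixes H A B C :: int
  assumes H: "2 \<le> H" "even H" and AB: "A < B" and BC: "B < C"
    and eq: "H * (A * B + B * C + C * A) + A + B + C = A * B * C"
  shows "A < 3 * H \<and> H < 2 * (3 * H - A)\<^sup>2"
proof -
  define t b c where "t = 3 * H - A" and "b = B - 3 * H" and "c = C - 3 * H"
  have zero: "shifted_defect H (- t) b c = 0"
    using shifted_defect_eq[of H A B C] eq by (simp add: t_def b_def c_def)
  have ord: "- t < b" "b < c" using AB BC by (auto simp: t_def b_def c_def)
  have t: "1 \<le> t"
    using shifted_defect_pos[of H "- t" b c] H ord zero by force
  moreover have "H < 2 * t\<^sup>2"
  proof (rule ccontr)
    assume "\<not> H < 2 * t\<^sup>2"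
    then have tH: "2 * t\<^sup>2 \<le> H" by simp
    have "t \<le> t\<^sup>2" using t by (simp add: power2_eq_square)
    with tH have tH': "2 * t \<le> H" by simp
    have bc: "t + 1 \<le> b + c"
    proof (rule ccontr)
      assume "\<not> t + 1 \<le> b + c"
      then have "shifted_defect H (- t) b c < 0"
        using H t tH' ord by (intro shifted_defect_neg) auto
      with zero show False by simp
    qed
    have ne: "(H, t) \<notin> {(2, 1), (4, 1), (8, 2), (18, 3)}"
    proof
      assume "(H, t) \<in> {(2, 1), (4, 1), (8, 2), (18, 3)}"
      from no_small_solution[OF this _ AB BC] eq show False by (simp add: t_def)
    qed
    have "1 - t \<le> b" using ord by simp
    from shifted_defect_lower_bound[OF H(1) t tH' this ord(2) bc] lower_bound_pos[OF H(2) t tH ne] zero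
    show False by linarith
  qed
  ultimately show ?thesis by (simp add: t_def)
qed

section \<open>The case \<open>K \<ge> 2\<close>\<close>

text \<open>Otherwise \<open>H \<le> 2 * A / 5\<close>. As \<open>B * C\<close> is the largest
  product, the quadratic terms give at most \<open>6/5\<close> of \<open>A * B * C\<close>; as
  \<open>A\<close> and \<open>B\<close> are at least 5, the linear ones give less than
  \<open>3/25\<close> of it. The total stays below \<open>2 * A * B * C\<close>.\<close>

lemma large_quotient_bound:
  fixes H A B C K :: int
  assumes H: "2 \<le> H" and A: "0 < A" "A < B" "B < C" and K: "2 \<le> K"
    and eq: "H * (A * B + B * C + C * A) + A + B + C = K * (A * B * C)"
  shows "2 * A < 5 * H"
proof (rule ccontr)
  assume "\<not> 2 * A < 5 * H"
  then have h: "5 * H \<le> 2 * A" by simp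
  have le: "A * B \<le> B * C" "C * A \<le> B * C"
    using A mult_mono[of A C B B] mult_mono[of C C A B] by (auto simp: mult.commute)
  have "5 * (H * (A * B + B * C + C * A)) \<le> 5 * (H * (3 * (B * C)))"
    using le H by simp
  also have "\<dots> = 5 * H * (3 * (B * C))" by simp
  also have "\<dots> \<le> 2 * A * (3 * (B * C))"
    using h A by (intro mult_right_mono) auto
  finally have 1: "5 * (H * (A * B + B * C + C * A)) \<le> 6 * (A * B * C)" by simp
  have 2: "2 * (A * B * C) \<le> K * (A * B * C)"
    using K A by (intro mult_right_mono) auto
  have "5 * 5 * C \<le> A * B * C"
    using h H A by (intro mult_right_mono mult_mono) auto
  with 1 2 eq A show False by linarith
qed

section \<open>From divisibility to the equation for \<open>A\<close>, \<open>B\<close>,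
  \<open>C\<close>\<close>

text \<open>The lone summand \<open>Z\<close> forces a common divisor of \<open>X\<close> and
  \<open>Y\<close> to divide \<open>Z\<close> too.\<close>

lemma coprime_if_dvd_symmetric:
  fixes X Y Z H :: int
  assumes "gcd X (gcd Y Z) = 1" and "X dvd H * Y * Z + Y + Z"
  shows "coprime X Y"
proof (rule coprimeI)
  fix d assume d: "d dvd X" "d dvd Y"
  have "d dvd H * Y * Z + Y + Z" using d assms(2) dvd_trans by blast
  moreover have "d dvd H * Y * Z + Y" using d by simp
  ultimately have "d dvd Z" using dvd_add_right_iff by blast
  with d have "d dvd gcd X (gcd Y Z)" by simp
  with assms(1) show "is_unit d" by simp
qed

theorem theorem4p1:
  fixes n p q r :: int
  assumes "K3N n p q r"
  shows "real_of_int (korselt_A p q r)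
           < 3 * real_of_int (korselt_H p q r) - sqrt (real_of_int (korselt_H p q r) / 2)"
proof -
  define H where "H = korselt_H p q r"
  define A where "A = korselt_A p q r"
  define B where "B = (q - 1) div H"
  define C where "C = (r - 1) div H"
  note K = assms[unfolded K3N_def]
  have p: "p = H * A + 1" using korselt_A_exact[of p q r] by (simp add: A_def H_def mult.commute)
  have "H dvd q - 1" "H dvd r - 1" unfolding H_def korselt_H_def by (meson gcd_dvd1 gcd_dvd2 dvd_trans)+
  then have q: "q = H * B + 1" and r: "r = H * C + 1" by (simp_all add: B_def C_def)
  have "even H"
    using K by (simp add: H_def korselt_H_def)
  have "0 < H" using K by (simp add: H_def korselt_H_def)
  with \<open>even H\<close> have H: "2 \<le> H" by (auto elim!: evenE)
  have A: "0 < A" and AB: "A < B" and BC: "B < C"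
  proof -
    have "H * 0 < H * A" "H * A < H * B" "H * B < H * C"
      using K p q r by linarith+
    then show "0 < A" "A < B" "B < C"
      using \<open>0 < H\<close> by (simp_all only: mult_less_cancel_left_pos)
  qed
  have e: "H * A = p - 1" "H * B = q - 1" "H * C = r - 1"
    using p q r by linarith+
  have "H * gcd A (gcd B C) = gcd (H * A) (gcd (H * B) (H * C))"
    using H by (simp add: gcd_mult_distrib_int[symmetric])
  also have "\<dots> = H"
    by (simp only: e korselt_H_def[symmetric] H_def[symmetric])
  finally have g: "gcd A (gcd B C) = 1" using H by simp
  have "H * A dvd p * q * r - 1" "H * B dvd q * r * p - 1" "H * C dvd r * p * q - 1"
    unfolding e using K by (auto simp: mult_ac)
  \<comment> \<open>Modulo \<open>H * X\<close>, \<open>x * y * z - 1\<close> is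
    \<open>y * z - 1 = H * (H * Y * Z + Y + Z)\<close>; then \<open>H\<close> cancels.\<close>
  moreover have "X dvd H * Y * Z + Y + Z"
    if "H * X dvd x * y * z - 1" "x = H * X + 1" "y = H * Y + 1" "z = H * Z + 1" for X Y Z x y z
  proof -
    have "x * y * z - 1 = H * X * (y * z) + H * (H * Y * Z + Y + Z)"
      using that(2-) by (simp add: algebra_simps)
    with that(1) have "H * X dvd H * (H * Y * Z + Y + Z)"
      by (metis dvd_add_right_iff dvd_triv_left)
    with H show ?thesis by simp
  qed
  ultimately have dA: "A dvd H * B * C + B + C" and dB: "B dvd H * C * A + C + A"
    and dC: "C dvd H * A * B + A + B"
    using p q r by blast+
  have cop: "coprime A B" "coprime B C" "coprime C A"
    by (rule coprime_if_dvd_symmetric[OF _ dA] coprime_if_dvd_symmetric[OF _ dB]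
          coprime_if_dvd_symmetric[OF _ dC]; use g in \<open>simp add: gcd.commute gcd.left_commute\<close>)+
  let ?S = "H * (A * B + B * C + C * A) + A + B + C"
  \<comment> \<open>Modulo each of \<open>A\<close>, \<open>B\<close>, \<open>C\<close>, the
    symmetric sum reduces to the expression that variable is known to divide.\<close>
  have "?S = (H * B * C + B + C) + A * (H * B + H * C + 1)"
    "?S = (H * C * A + C + A) + B * (H * C + H * A + 1)"
    "?S = (H * A * B + A + B) + C * (H * A + H * B + 1)"
    by (simp_all add: algebra_simps)
  then have "A dvd ?S" "B dvd ?S" "C dvd ?S"
    using dA dB dC by (metis dvd_add dvd_triv_left)+
  then have "A * B * C dvd ?S"
    using cop by (intro divides_mult) (auto simp: coprime_commute)
  then obtain k where k: "?S = k * (A * B * C)" by (metis dvdE mult.commute)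
  have "0 < ?S" using A AB BC H by (intro add_pos_pos mult_pos_pos) auto
  moreover have "0 < A * B * C" using A AB BC by (intro mult_pos_pos) auto
  ultimately have "0 < k" unfolding k by (rule zero_less_mult_pos2)
  have bound: "A < 3 * H \<and> H < 2 * (3 * H - A)\<^sup>2"
  proof (cases "k = 1")
    case True
    with k show ?thesis using unit_quotient_bound[OF H \<open>even H\<close> AB BC] by simp
  next
    case False
    \<comment> \<open>This makes \<open>3 * H - A\<close> exceed \<open>H / 2\<close>; being a
      positive integer, it is at most its square.\<close>
    then have "2 * A < 5 * H" using large_quotient_bound[OF H A AB BC _ k] \<open>0 < k\<close> by simp
    then have h: "H < 2 * (3 * H - A)" by simp
    with H have "1 \<le> 3 * H - A" by simp
    then have "3 * H - A \<le> (3 * H - A)\<^sup>2" by (rule self_le_power) simp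
    with h H show ?thesis by simp
  qed
  then have "real_of_int H < real_of_int (2 * (3 * H - A)\<^sup>2)"
    by (simp only: of_int_less_iff)
  then have "sqrt (real_of_int H / 2) < real_of_int (3 * H - A)"
    using bound by (intro real_less_lsqrt) (auto simp: power2_eq_square)
  then show ?thesis by (simp add: A_def H_def)
qed

end
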